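(* Let $p\ge 5$ be an integer, $\nu=p/2-1$, and let $\Phi_\nu,R_\nu$ be the modified-Bessel potential and ratio defined in the context. Let $(F,A)$ be a paired realization, i.e. real functions on $[0,\infty)$ with $F$ differentiable, $F'=A$ and $A(0)=0$. Let $C\ge 2$ be the number of classes, $\mu_1,\dots,\mu_C\in\mathbb R^p$ unit vectors, $k_j\ge 0$, $c_j\in\mathbb R$, $\tau>0$, $f\in\mathbb R^p$, $y\in\{1,\dots,C\}$, and form $r_j,q_j,\widehat q_j,P,\pi,L_y,\widehat L_y$ as in the context. Suppose $e$ is a finite nonnegative function, integrable on each interval $[\min(k_j,r_j),\max(k_j,r_j)]$, with $|R_\nu(x)-A(x)|\le e(x)$ for every $x$ in each of these intervals. Put $d_j=\int_{\min(k_j,r_j)}^{\max(k_j,r_j)}e(x)\,dx$, $d=\max_j d_j$, and let $a_j$ be real numbers with $|R_\nu(r_j)-A(r_j)|\le a_j$ for all $j$. Define $$S_j^{\pm}=\sum_{i\ne j}\pi_i\{\exp[\pm(d_i+d_j)]-1\},\qquad \ell_j=\frac{\pi_j}{1+S_j^+},\qquad u_j=\min\Big\{1,\frac{\pi_j}{1+S_j^-}\Big\},$$ (the denominators are positive) and $$B_L=\max\{\log(1+S_y^+),\,-\log(1+S_y^-)\},$$ $$B_P=\min\Big\{\tanh(d/2),\ \tfrac12\sum_j\max(\pi_j-\ell_j,\,u_j-\pi_j)\Big\},$$ $$B_g=\frac{2B_P+\sum_{j\ne y}\pi_j a_j+(1-\pi_y)a_y}{\tau}.$$ Then $$|\widehat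 L_y-L_y|\le B_L,\qquad \operatorname{TV}(P,\pi)\le B_P,\qquad \lVert\nabla_f\widehat L_y-\nabla_fL_y\rVert\le B_g,$$ and furthermore $$B_L\le d_y+d,\qquad B_P\le\tanh(d/2),\qquad B_g\le\frac{2\tanh(d/2)+\max_j a_j+a_y}{\tau}.$$
   Context: $I_\nu$ is the modified Bessel function of the first kind. For $x>0$, $\Phi_\nu(x)=\log I_\nu(x)-\nu\log x$ and $R_\nu(x)=I_{\nu+1}(x)/I_\nu(x)$, both extended continuously to $x=0$ (so $R_\nu(0)=0$); one has $\Phi_\nu'=R_\nu$. Given the state: $v_j=k_j\mu_j+f/\tau$, $r_j=\lVert v_j\rVert$ (Euclidean norm), exact scores $q_j=\Phi_\nu(r_j)-\Phi_\nu(k_j)+c_j$, approximate scores $\widehat q_j=F(r_j)-F(k_j)+c_j$. Then $P=\operatorname{softmax}(q)$, $\pi=\operatorname{softmax}(\widehat q)$, $L_y=\log\sum_j e^{q_j}-q_y$, $\widehat L_y=\log\sum_j e^{\widehat q_j}-\widehat q_y$. Total variation is $\operatorname{TV}(P,\pi)=\frac12\sum_j|P_j-\pi_j|$. The gradient $\nabla_f$ is the Euclidean gradient with respect to $f$, with $\mu_j,k_j,c_j,\tau$ held fixed. *)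

theory Defs
  imports "HOL-Analysis.Analysis"
begin

(* Only used for x > 0, where powr is the usual real power. *)
definition bessel_I :: "real \<Rightarrow> real \<Rightarrow> real" where
  "bessel_I \<nu> x =
     (\<Sum>m. (x / 2) powr (2 * real m + \<nu>) / (fact m * Gamma (real m + \<nu> + 1)))"

(* The values at 0 are the continuous extensions from the right; negative
   arguments never occur. *)
definition bessel_Phi :: "real \<Rightarrow> real \<Rightarrow> real" where
  "bessel_Phi \<nu> x =
     (if x = 0 then Lim (at_right 0) (\<lambda>t. ln (bessel_I \<nu> t) - \<nu> * ln t)
      else ln (bessel_I \<nu> x) - \<nu> * ln x)"

definition bessel_R :: "real \<Rightarrow> real \<Rightarrow> real" where
  "bessel_R \<nu> x =
     (if x = 0 then Lim (at_right 0) (\<lambda>t. bessel_I (\<nu> + 1) t / bessel_I \<nu> t)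
      else bessel_I (\<nu> + 1) x / bessel_I \<nu> x)"

definition state_radius ::
  "('c \<Rightarrow> real) \<Rightarrow> ('c \<Rightarrow> real ^ 'p) \<Rightarrow> real \<Rightarrow> real ^ 'p \<Rightarrow> 'c \<Rightarrow> real" where
  "state_radius k \<mu> \<tau> f j = norm (k j *\<^sub>R \<mu> j + f /\<^sub>R \<tau>)"

(* Exact scores for G = bessel_Phi \<nu>, approximate scores for G = F. *)
definition score ::
  "(real \<Rightarrow> real) \<Rightarrow> ('c \<Rightarrow> real) \<Rightarrow> ('c \<Rightarrow> real ^ 'p) \<Rightarrow> ('c \<Rightarrow> real) \<Rightarrow> real
     \<Rightarrow> real ^ 'p \<Rightarrow> 'c \<Rightarrow> real" where
  "score G k \<mu> c \<tau> f j = G (state_radius k \<mu> \<tau> f j) - G (k j) + c j"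

definition softmax :: "('c::finite \<Rightarrow> real) \<Rightarrow> 'c \<Rightarrow> real" where
  "softmax q j = exp (q j) / (\<Sum>i\<in>UNIV. exp (q i))"

definition log_loss :: "('c::finite \<Rightarrow> real) \<Rightarrow> 'c \<Rightarrow> real" where
  "log_loss q y = ln (\<Sum>j\<in>UNIV. exp (q j)) - q y"

definition TV :: "('c::finite \<Rightarrow> real) \<Rightarrow> ('c \<Rightarrow> real) \<Rightarrow> real" where
  "TV P Q = (1 / 2) * (\<Sum>j\<in>UNIV. \<bar>P j - Q j\<bar>)"

end

theory Submission
  imports Defs
begin

text \<open>
  Up to the factor \<open>(x / 2) powr \<nu>\<close>, the Bessel function \<open>I\<^sub>\<nu>\<close> is an entire power series \<open>h\<^sub>\<nu>\<close> in
  \<open>x\<^sup>2 / 4\<close> with \<open>h\<^sub>\<nu>' = h\<^sub>\<nu>\<^sub>+\<^sub>1\<close>; this gives \<open>\<Phi>\<^sub>\<nu>' = R\<^sub>\<nu>\<close>, also at 0, and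
  \<open>R\<^sub>\<nu> \<le> 1\<close> follows termwise from AM-GM.  Integrating \<open>\<bar>R\<^sub>\<nu> - A\<bar> \<le> e\<close> bounds the score errors
  \<open>\<delta>\<^sub>j\<close> by \<open>d\<^sub>j\<close>, and \<open>\<pi>\<^sub>j / P\<^sub>j = \<Sum>\<^sub>i \<pi>\<^sub>i exp (\<delta>\<^sub>i - \<delta>\<^sub>j)\<close> yields the loss bound and
  \<open>\<ell>\<^sub>j \<le> P\<^sub>j \<le> u\<^sub>j\<close>.  For the tanh bound, the total variation is attained on
  the event \<open>P \<ge> \<pi>\<close>, whose odds change at most by the factor \<open>exp (2 d)\<close>.  The gradients are combinations
  of the directions \<open>v\<^sub>j / r\<^sub>j\<close>, which have norm at most 1; split the difference into
  \<open>(\<pi> - P) R\<^sub>\<nu>\<close> and \<open>\<pi> (A - R\<^sub>\<nu>)\<close> parts.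
\<close>

section \<open>Power series of the modified Bessel functions\<close>

definition bessel_series :: "real \<Rightarrow> real \<Rightarrow> real" where
  "bessel_series \<nu> z = (\<Sum>m. 1 / (fact m * Gamma (real m + \<nu> + 1)) * z ^ m)"

lemma Gamma_plus1_pos:
  fixes x :: real
  assumes "x > 0"
  shows "Gamma (x + 1) = x * Gamma x"
  using Gamma_plus1[of x] assms nonpos_Ints_nonpos[of x] by fastforce

text \<open>Each unit step multiplies \<open>Gamma\<close> by a factor at least 1. This lets the
  exponential series dominate \<open>bessel_series\<close>, so the latter converges
  everywhere.\<close>

lemma Gamma_add_nat_ge:
  fixes \<nu> :: real
  assumes "\<nu> \<ge> 0"
  shows "Gamma (real m + \<nu> + 1) \<ge> Gamma (\<nu> + 1)"
proof (induction m)
  case (Suc m)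
  have "Gamma (real (Suc m) + \<nu> + 1) = (real m + \<nu> + 1) * Gamma (real m + \<nu> + 1)"
    using Gamma_plus1_pos[of "real m + \<nu> + 1"] assms by (simp add: add_ac)
  also have "\<dots> \<ge> 1 * Gamma (real m + \<nu> + 1)"
    using assms by (intro mult_right_mono) auto
  finally show ?case using Suc by simp
qed simp

lemma summable_bessel_series:
  fixes \<nu> z :: real
  assumes "\<nu> \<ge> 0"
  shows "summable (\<lambda>m. 1 / (fact m * Gamma (real m + \<nu> + 1)) * z ^ m)"
proof (rule summable_comparison_test')
  show "summable (\<lambda>m. 1 / Gamma (\<nu> + 1) * (inverse (fact m) * \<bar>z\<bar> ^ m))"
    by (intro summable_mult summable_exp)
  fix m :: nat
  have pos: "Gamma (\<nu> + 1) > 0" using assms by simp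
  have "1 / Gamma (real m + \<nu> + 1) \<le> 1 / Gamma (\<nu> + 1)"
    using Gamma_add_nat_ge[OF assms] pos by (intro divide_left_mono) (auto intro!: mult_pos_pos simp: assms add_nonneg_pos)
  then have "1 / Gamma (real m + \<nu> + 1) * (\<bar>z\<bar> ^ m / fact m) \<le> 1 / Gamma (\<nu> + 1) * (\<bar>z\<bar> ^ m / fact m)"
    by (intro mult_right_mono) auto
  moreover have "Gamma (real m + \<nu> + 1) > 0" using assms by simp
  ultimately show "norm (1 / (fact m * Gamma (real m + \<nu> + 1)) * z ^ m)
      \<le> 1 / Gamma (\<nu> + 1) * (inverse (fact m) * \<bar>z\<bar> ^ m)"
    by (simp add: abs_mult power_abs field_simps)
qed

text \<open>In the differentiated series the factor m + 1 cancels against the factorial, while the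
  index shift raises the argument of \<open>Gamma\<close> by one. That is the coefficient sequence
  for order \<nu> + 1.\<close>

lemma DERIV_bessel_series:
  fixes \<nu> z :: real
  assumes "\<nu> \<ge> 0"
  shows "(bessel_series \<nu> has_real_derivative bessel_series (\<nu> + 1) z) (at z)"
proof -
  let ?c = "\<lambda>m. 1 / (fact m * Gamma (real m + \<nu> + 1))"
  have "diffs ?c = (\<lambda>m. 1 / (fact m * Gamma (real m + (\<nu> + 1) + 1)))"
    by (rule ext) (simp add: diffs_def field_simps del: of_nat_Suc, simp add: algebra_simps)
  moreover have "((\<lambda>z. \<Sum>m. ?c m * z ^ m) has_real_derivative (\<Sum>m. diffs ?c m * z ^ m)) (at z)"
    by (intro termdiffs_strong_converges_everywhere summable_bessel_series assms)
  ultimately show ?thesis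
    by (simp add: bessel_series_def[abs_def])
qed

lemma bessel_series_pos:
  assumes "\<nu> \<ge> 0" "z \<ge> 0"
  shows "bessel_series \<nu> z > 0"
  unfolding bessel_series_def
proof (rule suminf_pos2[where i = 0])
  show "0 \<le> 1 / (fact m * Gamma (real m + \<nu> + 1)) * z ^ m" for m
    using assms Gamma_real_pos[of "real m + \<nu> + 1"] by simp
qed (use assms summable_bessel_series in auto)

lemma bessel_I_eq:
  assumes "x > 0" "\<nu> \<ge> 0"
  shows "bessel_I \<nu> x = (x / 2) powr \<nu> * bessel_series \<nu> (x\<^sup>2 / 4)"
proof -
  have "(x / 2) powr (2 * real m + \<nu>) / (fact m * Gamma (real m + \<nu> + 1))
      = (x / 2) powr \<nu> * (1 / (fact m * Gamma (real m + \<nu> + 1)) * (x\<^sup>2 / 4) ^ m)" for m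
  proof -
    have "(x / 2) powr (2 * real m) = (x / 2) ^ (2 * m)"
      using assms powr_realpow[of "x / 2" "2 * m"] by simp
    then show ?thesis
      by (simp add: powr_add power_mult power2_eq_square)
  qed
  then show ?thesis
    unfolding bessel_I_def bessel_series_def
    using summable_bessel_series[OF assms(2)] by (simp only: suminf_mult)
qed

text \<open>Subtracting \<nu> ln x cancels the part of the prefactor that is singular at 0. The
  right-hand side makes sense at 0 and so identifies the continuous extension.\<close>

lemma ln_bessel_I:
  assumes "x > 0" "\<nu> \<ge> 0"
  shows "ln (bessel_I \<nu> x) - \<nu> * ln x = ln (bessel_series \<nu> (x\<^sup>2 / 4)) - \<nu> * ln 2"
proof -
  have "bessel_series \<nu> (x\<^sup>2 / 4) > 0" using assms by (intro bessel_series_pos) auto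
  then show ?thesis
    using assms by (simp add: bessel_I_eq ln_mult ln_powr ln_div algebra_simps)
qed

lemma bessel_I_ratio:
  assumes "x > 0" "\<nu> \<ge> 0"
  shows "bessel_I (\<nu> + 1) x / bessel_I \<nu> x
    = x / 2 * bessel_series (\<nu> + 1) (x\<^sup>2 / 4) / bessel_series \<nu> (x\<^sup>2 / 4)"
  using assms by (simp add: bessel_I_eq powr_add)

lemma isCont_bessel_series:
  assumes "\<nu> \<ge> 0"
  shows "isCont (bessel_series \<nu>) z"
  using DERIV_bessel_series[OF assms] by (rule DERIV_isCont)

lemma continuous_bessel_series_square:
  assumes "\<nu> \<ge> 0"
  shows "isCont (\<lambda>x. bessel_series \<nu> (x\<^sup>2 / 4)) x"
  by (rule isCont_o2[where g = "bessel_series \<nu>"])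
     (auto intro!: isCont_bessel_series assms)

lemma bessel_Phi_eq:
  assumes "x \<ge> 0" "\<nu> \<ge> 0"
  shows "bessel_Phi \<nu> x = ln (bessel_series \<nu> (x\<^sup>2 / 4)) - \<nu> * ln 2"
proof (cases "x = 0")
  case True
  let ?g = "\<lambda>x. ln (bessel_series \<nu> (x\<^sup>2 / 4)) - \<nu> * ln 2"
  have "bessel_series \<nu> 0 > 0" using assms by (intro bessel_series_pos) auto
  then have "isCont ?g 0"
    by (intro continuous_intros continuous_bessel_series_square assms) auto
  \<comment> \<open>The value at 0 is defined as a right-hand limit; it is found by continuity of
    the closed form, which agrees with the defining expression for t > 0.\<close>
  then have "(?g \<longlongrightarrow> ?g 0) (at_right 0)"
    by (simp add: isCont_def filterlim_at_split)
  moreover have "\<forall>\<^sub>F t in at_right 0. ?g t = ln (bessel_I \<nu> t) - \<nu> * ln t"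
    using eventually_at_right_less[of "0::real"]
    by eventually_elim (simp add: ln_bessel_I assms)
  ultimately have "((\<lambda>t. ln (bessel_I \<nu> t) - \<nu> * ln t) \<longlongrightarrow> ?g 0) (at_right 0)"
    by (rule Lim_transform_eventually)
  then show ?thesis
    using True by (simp add: bessel_Phi_def tendsto_Lim)
qed (use assms in \<open>simp add: bessel_Phi_def ln_bessel_I\<close>)

lemma bessel_R_eq:
  assumes "x \<ge> 0" "\<nu> \<ge> 0"
  shows "bessel_R \<nu> x
    = x / 2 * bessel_series (\<nu> + 1) (x\<^sup>2 / 4) / bessel_series \<nu> (x\<^sup>2 / 4)"
proof (cases "x = 0")
  case True
  let ?g = "\<lambda>x. x / 2 * bessel_series (\<nu> + 1) (x\<^sup>2 / 4) / bessel_series \<nu> (x\<^sup>2 / 4)"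
  have "bessel_series \<nu> 0 > 0" using assms by (intro bessel_series_pos) auto
  then have "isCont ?g 0"
    by (intro continuous_intros continuous_bessel_series_square) (use assms in auto)
  then have "(?g \<longlongrightarrow> ?g 0) (at_right 0)"
    by (simp add: isCont_def filterlim_at_split)
  moreover have "\<forall>\<^sub>F t in at_right 0. ?g t = bessel_I (\<nu> + 1) t / bessel_I \<nu> t"
    using eventually_at_right_less[of "0::real"]
    by eventually_elim (simp add: bessel_I_ratio assms)
  ultimately have "((\<lambda>t. bessel_I (\<nu> + 1) t / bessel_I \<nu> t) \<longlongrightarrow> ?g 0) (at_right 0)"
    by (rule Lim_transform_eventually)
  then show ?thesis
    using True by (simp add: bessel_R_def tendsto_Lim)
qed (use assms in \<open>simp add: bessel_R_def bessel_I_ratio\<close>)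

lemma bessel_R_0:
  assumes "\<nu> \<ge> 0"
  shows "bessel_R \<nu> 0 = 0"
  using assms by (simp add: bessel_R_eq)

text \<open>The inner derivative of x^2/4 is x/2, exactly the factor in \<open>bessel_R_eq\<close>.
  The derivative is taken within \<open>{0..}\<close>, hence one-sided at 0, because the closed form
  of \<open>bessel_Phi\<close> is established only there.\<close>

lemma DERIV_bessel_Phi:
  assumes "x \<ge> 0" "\<nu> \<ge> 0"
  shows "(bessel_Phi \<nu> has_real_derivative bessel_R \<nu> x) (at x within {0..})"
proof (rule has_field_derivative_transform_within[where d = 1])
  let ?g = "\<lambda>x. ln (bessel_series \<nu> (x\<^sup>2 / 4)) - \<nu> * ln 2"
  have "bessel_series \<nu> (x\<^sup>2 / 4) > 0" using assms by (intro bessel_series_pos) auto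
  moreover have "((\<lambda>x. bessel_series \<nu> (x\<^sup>2 / 4)) has_real_derivative
      bessel_series (\<nu> + 1) (x\<^sup>2 / 4) * (x / 2)) (at x within {0..})"
    by (rule DERIV_chain2[OF DERIV_bessel_series[OF assms(2)]])
       (auto intro!: derivative_eq_intros)
  ultimately show "(?g has_real_derivative bessel_R \<nu> x) (at x within {0..})"
    using assms by (auto intro!: derivative_eq_intros simp: bessel_R_eq field_simps)
qed (use assms in \<open>auto simp: bessel_Phi_eq\<close>)

text \<open>With t = x/2 this is the bound of \<open>bessel_R\<close> by 1. Each term on the left is
  at most the mean of two consecutive terms on the right, and summing these means counts every term
  at most once.\<close>

lemma bessel_series_ratio_le:
  assumes "t \<ge> 0" "\<nu> \<ge> 0"
  shows "t * bessel_series (\<nu> + 1) (t\<^sup>2) \<le> bessel_series \<nu> (t\<^sup>2)"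
proof -
  define w where "w m = 1 / (fact m * Gamma (real m + \<nu> + 1)) * (t\<^sup>2) ^ m" for m
  define b where "b m = 1 / (fact m * Gamma (real m + (\<nu> + 1) + 1)) * (t\<^sup>2) ^ m" for m
  have w: "summable w" and b: "summable b"
    unfolding w_def b_def by (rule summable_bessel_series; use assms in simp)+
  have w': "summable (\<lambda>m. w (Suc m))" using w by (simp add: summable_Suc_iff)
  have w_nonneg: "w m \<ge> 0" for m
    using assms Gamma_real_pos[of "real m + \<nu> + 1"] by (simp add: w_def)
  have le: "t * b m \<le> 1 / 2 * (w m + w (Suc m))" for m
  proof -
    have G: "Gamma (real m + \<nu> + 2) = (real m + \<nu> + 1) * Gamma (real m + \<nu> + 1)"
      using Gamma_plus1_pos[of "real m + \<nu> + 1"] assms by (simp add: add_ac)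
    have pos: "real m + \<nu> + 1 > 0" using assms by simp
    have b: "b m = w m / (real m + \<nu> + 1)"
      using G by (simp add: b_def w_def add_ac)
    have ws: "w (Suc m) = w m * t\<^sup>2 / ((real m + 1) * (real m + \<nu> + 1))"
      using G by (simp add: w_def add_ac mult_ac)
    \<comment> \<open>AM-GM for two consecutive terms: \<open>(t b\<^sub>m)\<^sup>2 \<le> w\<^sub>m w\<^sub>m\<^sub>+\<^sub>1\<close>\<close>
    have "0 \<le> (t - (real m + 1))\<^sup>2 / (real m + 1)" by simp
    also have "\<dots> = t\<^sup>2 / (real m + 1) + (real m + 1) - 2 * t"
      by (simp add: power2_eq_square field_simps del: of_nat_Suc)
    finally have "2 * t \<le> (real m + \<nu> + 1) + t\<^sup>2 / (real m + 1)" using assms by simp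
    then have "2 * t / (real m + \<nu> + 1)
        \<le> ((real m + \<nu> + 1) + t\<^sup>2 / (real m + 1)) / (real m + \<nu> + 1)"
      using pos by (intro divide_right_mono) auto
    also have "\<dots> = 1 + t\<^sup>2 / ((real m + 1) * (real m + \<nu> + 1))"
      using pos by (simp add: add_divide_distrib)
    finally have "w m * (2 * t / (real m + \<nu> + 1))
        \<le> w m * (1 + t\<^sup>2 / ((real m + 1) * (real m + \<nu> + 1)))"
      by (intro mult_left_mono w_nonneg)
    then have "1 / 2 * (w m * (2 * t / (real m + \<nu> + 1)))
        \<le> 1 / 2 * (w m * (1 + t\<^sup>2 / ((real m + 1) * (real m + \<nu> + 1))))"
      by (rule mult_left_mono) simp
    moreover have "t * b m = 1 / 2 * (w m * (2 * t / (real m + \<nu> + 1)))"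
      by (simp add: b)
    moreover have "w m + w (Suc m) = w m * (1 + t\<^sup>2 / ((real m + 1) * (real m + \<nu> + 1)))"
      by (simp add: ws distrib_left)
    ultimately show ?thesis by (simp only:)
  qed
  have "t * suminf b = (\<Sum>m. t * b m)" using b by (rule suminf_mult[symmetric])
  also have "\<dots> \<le> (\<Sum>m. 1 / 2 * (w m + w (Suc m)))"
    by (intro suminf_le le summable_mult summable_add b w w')
  also have "\<dots> = 1 / 2 * (suminf w + (\<Sum>m. w (Suc m)))"
    by (simp only: suminf_mult[OF summable_add[OF w w']] suminf_add[OF w w'])
  \<comment> \<open>The shifted sum is the full sum without \<open>w 0\<close>, which is
    nonnegative.\<close>
  also have "\<dots> \<le> suminf w"
    using suminf_split_head[OF w] w_nonneg[of 0] by simp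
  finally show ?thesis
    by (simp add: bessel_series_def w_def[abs_def] b_def[abs_def])
qed

lemma bessel_R_bounds:
  assumes "x \<ge> 0" "\<nu> \<ge> 0"
  shows "0 \<le> bessel_R \<nu> x" "bessel_R \<nu> x \<le> 1"
proof -
  have "bessel_series \<nu> (x\<^sup>2 / 4) > 0" "bessel_series (\<nu> + 1) (x\<^sup>2 / 4) > 0"
    using assms by (auto intro!: bessel_series_pos)
  moreover have "x / 2 * bessel_series (\<nu> + 1) (x\<^sup>2 / 4) \<le> bessel_series \<nu> (x\<^sup>2 / 4)"
    using bessel_series_ratio_le[of "x / 2" \<nu>] assms by (simp add: power_divide)
  ultimately show "0 \<le> bessel_R \<nu> x" "bessel_R \<nu> x \<le> 1"
    using assms by (simp_all add: bessel_R_eq)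
qed

section \<open>Softmax and its exponential reweighting\<close>

lemma sum_exp_pos: "(\<Sum>i\<in>UNIV. exp (q i :: real)) > 0" for q :: "'c::finite \<Rightarrow> real"
  by (intro sum_pos) auto

lemma softmax_pos: "softmax q j > 0"
  unfolding softmax_def by (intro divide_pos_pos sum_exp_pos) simp

lemma sum_softmax: "(\<Sum>j\<in>UNIV. softmax q j) = 1"
  using sum_exp_pos[of q] by (simp add: softmax_def flip: sum_divide_distrib)

lemma log_loss_eq: "log_loss q y = - ln (softmax q y)"
  using sum_exp_pos[of q] by (simp add: log_loss_def softmax_def ln_div)

text \<open>Change of measure: \<open>softmax q\<close> is \<open>softmax q'\<close> tilted by the
  exponential of the score difference; the normalizing constant of \<open>q'\<close>
  cancels.\<close>

lemma softmax_reweight: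
  "softmax q j = softmax q' j * exp (q j - q' j) / (\<Sum>i\<in>UNIV. softmax q' i * exp (q i - q' i))"
proof -
  have "softmax q' i * exp (q i - q' i) = exp (q i) / (\<Sum>i\<in>UNIV. exp (q' i))" for i
    by (simp add: softmax_def exp_diff)
  then show ?thesis
    using sum_exp_pos[of q'] by (simp add: softmax_def[of q] flip: sum_divide_distrib)
qed

text \<open>The term i = j has exponent 0 and is split off, so that the remaining sum runs over the
  same indices as \<open>Sp\<close> and \<open>Sm\<close>.\<close>

lemma softmax_quotient:
  "softmax q' j / softmax q j
    = softmax q' j + (\<Sum>i\<in>UNIV - {j}. softmax q' i * exp ((q i - q' i) - (q j - q' j)))"
proof -
  let ?w = "\<lambda>i. softmax q' i * exp ((q i - q' i) - (q j - q' j))"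
  have "(\<Sum>i\<in>UNIV. softmax q' i * exp (q i - q' i)) = exp (q j - q' j) * (\<Sum>i\<in>UNIV. ?w i)"
    by (simp add: sum_distrib_left exp_diff)
  then have "softmax q' j / softmax q j = (\<Sum>i\<in>UNIV. ?w i)"
    using softmax_pos[of q' j] by (simp add: softmax_reweight[of q j q'])
  also have "\<dots> = ?w j + (\<Sum>i\<in>UNIV - {j}. ?w i)"
    by (rule sum.remove) auto
  finally show ?thesis by simp
qed

section \<open>Total variation bounds\<close>

lemma TV_le_sum_max:
  assumes "\<And>j. l j \<le> P j" "\<And>j. P j \<le> u j"
  shows "TV P Q \<le> 1 / 2 * (\<Sum>j\<in>UNIV. max (Q j - l j) (u j - Q j))"
proof -
  have "\<bar>P j - Q j\<bar> \<le> max (Q j - l j) (u j - Q j)" for j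
    using assms[of j] by linarith
  then show ?thesis
    unfolding TV_def by (intro mult_left_mono sum_mono) auto
qed

text \<open>Both families have the same total mass, so the positive and negative parts of their
  difference balance and each is half of the absolute sum.\<close>

lemma TV_eq_positive_part:
  assumes "(\<Sum>j\<in>UNIV. P j) = 1" "(\<Sum>j\<in>UNIV. Q j) = 1"
  shows "TV P Q = (\<Sum>j\<in>{j. P j \<ge> Q j}. P j - Q j)"
proof -
  let ?S = "{j. P j \<ge> Q j}"
  have split: "(\<Sum>j\<in>UNIV. g j) = (\<Sum>j\<in>?S. g j) + (\<Sum>j\<in>-?S. g j)" for g :: "'a \<Rightarrow> real"
    by (subst sum.union_disjoint[symmetric]) auto
  have "(\<Sum>j\<in>?S. P j - Q j) + (\<Sum>j\<in>-?S. P j - Q j) = 0"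
    using assms split[of P] split[of Q] by (simp add: sum_subtractf)
  moreover have "(\<Sum>j\<in>?S. \<bar>P j - Q j\<bar>) = (\<Sum>j\<in>?S. P j - Q j)"
    by (intro sum.cong) auto
  moreover have "(\<Sum>j\<in>-?S. \<bar>P j - Q j\<bar>) = - (\<Sum>j\<in>-?S. P j - Q j)"
    unfolding sum_negf[symmetric] by (intro sum.cong) auto
  ultimately show ?thesis
    by (simp add: TV_def split[of "\<lambda>j. \<bar>P j - Q j\<bar>"])
qed

lemma tanh_half: "tanh (d / 2) = (exp d - 1) / (exp d + 1)" for d :: real
proof -
  have "exp d + 1 > 0" by (simp add: add_pos_pos)
  then show ?thesis by (simp add: tanh_real_altdef exp_minus divide_simps)
qed

text \<open>Multiplying the odds of an event of probability p by s^2 moves its probability by at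
  most the right-hand side, which is \<open>tanh (d / 2)\<close> when s = exp d.\<close>

lemma odds_shift_le:
  fixes p s :: real
  assumes "0 \<le> p" "p \<le> 1" "s \<ge> 1"
  shows "s * p / (s * p + (1 - p) / s) - p \<le> (s - 1) / (s + 1)"
proof -
  have D: "s * s * p + (1 - p) > 0"
  proof (cases "p = 0")
    case False
    then have "s * s * p > 0" using assms by simp
    then show ?thesis using assms by simp
  qed simp
  have "s * p / (s * p + (1 - p) / s) = s * s * p / (s * s * p + (1 - p))"
    using assms by (simp add: field_simps)
  also have "\<dots> - p = p * (1 - p) * (s * s - 1) / (s * s * p + (1 - p))"
    using D by (simp add: field_simps)
  also have "\<dots> \<le> (s - 1) / (s + 1)"
  proof -
    \<comment> \<open>This nonnegative product is exactly the difference of the two sides of the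
      next inequality. The square vanishes at p = 1 / (s + 1), where the bound is attained.\<close>
    have "0 \<le> (s - 1) * ((1 - p) - p * s)\<^sup>2" using assms by simp
    then have "p * (1 - p) * (s * s - 1) * (s + 1) \<le> (s - 1) * (s * s * p + (1 - p))"
      by (simp add: power2_eq_square algebra_simps)
    then show ?thesis using D assms by (simp add: divide_simps mult_ac)
  qed
  finally show ?thesis by simp
qed

lemma TV_softmax_le_tanh:
  fixes q q' :: "'c::finite \<Rightarrow> real"
  assumes d: "\<And>j. \<bar>q j - q' j\<bar> \<le> d"
  shows "TV (softmax q) (softmax q') \<le> tanh (d / 2)"
proof -
  define S where "S = {j. softmax q j \<ge> softmax q' j}"
  define w where "w = (\<lambda>j. softmax q' j * exp (q j - q' j))"
  define p where "p = sum (softmax q') S"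
  define s where "s = exp d"
  \<comment> \<open>Any class serves here; \<open>undefined\<close> merely names one.\<close>
  have "d \<ge> 0" using d[of undefined] by linarith
  then have s: "s \<ge> 1" by (simp add: s_def)
  have split: "sum g UNIV = sum g S + sum g (-S)" for g :: "'c \<Rightarrow> real"
    by (subst sum.union_disjoint[symmetric]) auto
  have p': "sum (softmax q') (-S) = 1 - p"
    using sum_softmax[of q'] split[of "softmax q'"] by (simp add: p_def)
  have p: "0 \<le> p" "0 \<le> 1 - p"
    unfolding p'[symmetric] by (simp_all add: p_def sum_nonneg less_imp_le softmax_pos)
  have w_le: "w j \<le> s * softmax q' j" and w_ge: "softmax q' j / s \<le> w j" for j
  proof -
    have "exp (q j - q' j) \<le> s" "exp (- d) \<le> exp (q j - q' j)"
      using d[of j] by (auto simp: s_def)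
    then show "w j \<le> s * softmax q' j" "softmax q' j / s \<le> w j"
      using softmax_pos[of q' j] by (auto simp: w_def s_def exp_minus divide_inverse mult_ac)
  qed
  have wpos: "w j > 0" for j by (simp add: w_def softmax_pos)
  have A: "sum w S \<le> s * p" and A0: "0 \<le> sum w S"
    by (simp_all add: p_def sum_distrib_left sum_mono w_le sum_nonneg less_imp_le wpos)
  have B: "(1 - p) / s \<le> sum w (-S)"
    unfolding p'[symmetric] sum_divide_distrib by (intro sum_mono w_ge)
  have AB: "sum w S + sum w (-S) > 0"
    unfolding split[symmetric] by (intro sum_pos wpos) auto
  have D: "s * p + (1 - p) / s > 0"
  proof (cases "p = 0")
    case False
    then have "s * p > 0" using p s by simp
    then show ?thesis using p s by (intro add_pos_nonneg) auto
  qed (use s in simp)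
  have "TV (softmax q) (softmax q') = sum (softmax q) S - p"
    by (simp add: TV_eq_positive_part sum_softmax S_def p_def sum_subtractf)
  also have "sum (softmax q) S = sum w S / (sum w S + sum w (-S))"
    by (simp add: softmax_reweight[of q _ q'] w_def flip: split sum_divide_distrib)
  also have "\<dots> \<le> s * p / (s * p + (1 - p) / s)"
  proof -
    \<comment> \<open>The quotient x / (x + y) grows with x and falls with y, so the extreme case
      has \<open>S\<close> inflated by s and its complement deflated by s. After
      cross-multiplication only this product inequality remains.\<close>
    have "sum w S * ((1 - p) / s) \<le> s * p * sum w (-S)"
      using A A0 B p s by (intro mult_mono) auto
    then have "sum w S * (s * p + (1 - p) / s) \<le> s * p * (sum w S + sum w (-S))"
      by (simp add: distrib_left mult_ac)
    then show ?thesis using AB D by (simp add: divide_le_eq pos_le_divide_eq mult_ac)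
  qed
  also have "\<dots> - p \<le> tanh (d / 2)"
    using odds_shift_le[of p s] p s by (simp add: tanh_half s_def)
  finally show ?thesis by simp
qed

section \<open>Gradients of the scores and losses\<close>

text \<open>The norm has no gradient at 0, but a profile with zero slope there still composes to a
  differentiable function. This is where \<open>A 0 = 0\<close> and \<open>bessel_R_0\<close> enter;
  at v = 0 the formula gives 0 because \<open>sgn 0 = 0\<close>.\<close>

lemma GDERIV_radial:
  fixes v :: "'a::real_inner"
  assumes G: "(G has_real_derivative D) (at (norm v) within {0..})"
    and D: "v = 0 \<Longrightarrow> D = 0"
  shows "GDERIV (\<lambda>x. G (norm x)) v :> D *\<^sub>R sgn v"
proof (cases "v = 0")
  case False
  then have "norm v \<in> interior {0..}" by (simp add: interior_real_atLeast)
  then have "(G has_real_derivative D) (at (norm v))"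
    using G at_within_interior by metis
  then show ?thesis by (intro GDERIV_DERIV_compose GDERIV_norm False)
next
  case True
  then have "(G has_derivative (\<lambda>h. 0)) (at 0 within {0..})"
    using G D by (simp add: has_field_derivative_def flip: lambda_zero)
  \<comment> \<open>In epsilon-delta form, zero slope bounds the increment of \<open>G\<close> by a
    small multiple of its argument; substituting the norm of x yields differentiability at the
    origin.\<close>
  then have lim: "\<exists>\<delta>>0. \<forall>x\<in>{0..}. norm (x - 0) < \<delta> \<longrightarrow> norm (G x - G 0) \<le> \<epsilon> * norm (x - 0)"
    if "\<epsilon> > 0" for \<epsilon>
    using that by (simp add: has_derivative_within_alt)
  have "((\<lambda>x. G (norm x)) has_derivative (\<lambda>h. 0)) (at (0 :: 'a))"
    unfolding has_derivative_at_alt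
  proof (intro conjI allI impI)
    fix \<epsilon> :: real
    assume "\<epsilon> > 0"
    from lim[OF this] obtain \<delta> where "\<delta> > 0"
      "\<forall>x\<in>{0..}. norm (x - 0) < \<delta> \<longrightarrow> norm (G x - G 0) \<le> \<epsilon> * norm (x - 0)"
      by blast
    then show "\<exists>\<delta>>0. \<forall>x::'a. norm (x - 0) < \<delta> \<longrightarrow>
        norm (G (norm x) - G (norm (0::'a)) - 0) \<le> \<epsilon> * norm (x - 0)"
      by (intro exI[of _ \<delta>]) auto
  qed simp
  then show ?thesis using True D by (simp add: gderiv_def)
qed

lemma GDERIV_score:
  assumes G: "(G has_real_derivative D) (at (state_radius k \<mu> \<tau> f j) within {0..})"
    and D: "state_radius k \<mu> \<tau> f j = 0 \<Longrightarrow> D = 0"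
  shows "GDERIV (\<lambda>g. score G k \<mu> c \<tau> g j) f :> (D / \<tau>) *\<^sub>R sgn (k j *\<^sub>R \<mu> j + f /\<^sub>R \<tau>)"
proof -
  let ?v = "\<lambda>g. k j *\<^sub>R \<mu> j + g /\<^sub>R \<tau>"
  have "GDERIV (\<lambda>x. G (norm x)) (?v f) :> D *\<^sub>R sgn (?v f)"
    using G D by (intro GDERIV_radial) (auto simp: state_radius_def)
  then have "((\<lambda>x. G (norm x)) has_derivative (\<lambda>h. h \<bullet> (D *\<^sub>R sgn (?v f)))) (at (?v f))"
    by (simp add: gderiv_def)
  moreover have "(?v has_derivative (\<lambda>h. h /\<^sub>R \<tau>)) (at f)"
    by (auto intro!: derivative_eq_intros)
  ultimately have "((\<lambda>g. G (norm (?v g))) has_derivative (\<lambda>h. (h /\<^sub>R \<tau>) \<bullet> (D *\<^sub>R sgn (?v f)))) (at f)"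
    by (rule has_derivative_compose[rotated])
  then have "((\<lambda>g. score G k \<mu> c \<tau> g j) has_derivative (\<lambda>h. (h /\<^sub>R \<tau>) \<bullet> (D *\<^sub>R sgn (?v f)))) (at f)"
    unfolding score_def state_radius_def by (auto intro!: derivative_eq_intros)
  then show ?thesis
    by (simp add: gderiv_def divide_inverse mult_ac)
qed

lemma GDERIV_log_loss:
  fixes s :: "'a::real_inner \<Rightarrow> 'c::finite \<Rightarrow> real"
  assumes s: "\<And>j. GDERIV (\<lambda>x. s x j) x :> D j"
  shows "GDERIV (\<lambda>x. log_loss (s x) y) x :> (\<Sum>j\<in>UNIV. softmax (s x) j *\<^sub>R D j) - D y"
proof -
  let ?Z = "\<Sum>j\<in>UNIV. exp (s x j)"
  have Z: "?Z > 0" by (intro sum_pos) auto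
  have s': "((\<lambda>x. s x j) has_derivative (\<lambda>h. h \<bullet> D j)) (at x)" for j
    using s by (simp add: gderiv_def)
  have "((\<lambda>x. \<Sum>j\<in>UNIV. exp (s x j)) has_derivative (\<lambda>h. \<Sum>j\<in>UNIV. (h \<bullet> D j) * exp (s x j))) (at x)"
    by (auto intro!: derivative_eq_intros s')
  then have "((\<lambda>x. log_loss (s x) y) has_derivative
      (\<lambda>h. (\<Sum>j\<in>UNIV. (h \<bullet> D j) * exp (s x j)) * (1 / ?Z) - h \<bullet> D y)) (at x)"
    unfolding log_loss_def by (auto intro!: derivative_eq_intros s' Z simp: divide_inverse)
  then show ?thesis
    by (simp add: gderiv_def softmax_def inner_diff_right inner_sum_right sum_divide_distrib mult_ac)
qed

lemma norm_sum_scaleR_le: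
  fixes n :: "'c \<Rightarrow> 'a::real_normed_vector"
  assumes "\<And>j. j \<in> S \<Longrightarrow> norm (n j) \<le> 1"
  shows "norm (\<Sum>j\<in>S. w j *\<^sub>R n j) \<le> (\<Sum>j\<in>S. \<bar>w j\<bar>)"
proof -
  have "norm (w j *\<^sub>R n j) \<le> \<bar>w j\<bar>" if "j \<in> S" for j
    using mult_left_mono[OF assms[OF that], of "\<bar>w j\<bar>"] by simp
  then show ?thesis by (rule sum_norm_le)
qed

text \<open>Uses Q A - P R = (Q - P) R + Q (A - R). As R lies in [0, 1], the first part costs at
  most twice the total variation; the second is controlled by \<open>a\<close>.\<close>

lemma norm_gradient_diff_le:
  fixes P Q R A a :: "'c::finite \<Rightarrow> real" and n :: "'c \<Rightarrow> 'a::real_normed_vector"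
  assumes n: "\<And>j. norm (n j) \<le> 1" and R: "\<And>j. 0 \<le> R j" "\<And>j. R j \<le> 1"
    and a: "\<And>j. \<bar>R j - A j\<bar> \<le> a j"
    and Q: "\<And>j. 0 \<le> Q j" "Q y \<le> 1" and "\<tau> > 0"
  shows "norm (((\<Sum>j\<in>UNIV. Q j *\<^sub>R (A j / \<tau>) *\<^sub>R n j) - (A y / \<tau>) *\<^sub>R n y)
      - ((\<Sum>j\<in>UNIV. P j *\<^sub>R (R j / \<tau>) *\<^sub>R n j) - (R y / \<tau>) *\<^sub>R n y))
    \<le> (2 * TV P Q + (\<Sum>j\<in>UNIV - {y}. Q j * a j) + (1 - Q y) * a y) / \<tau>"
    (is "norm ?g \<le> _")
proof -
  \<comment> \<open>The separate label term contributes -(A - R) at y, so the weight there becomes Q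
    y - 1. This is the source of the factor 1 - Q y in the bound.\<close>
  define w where "w j = (Q j - (if j = y then 1 else 0)) * (A j - R j)" for j
  have g: "?g = (1 / \<tau>) *\<^sub>R ((\<Sum>j\<in>UNIV. ((Q j - P j) * R j) *\<^sub>R n j) + (\<Sum>j\<in>UNIV. w j *\<^sub>R n j))"
  proof -
    \<comment> \<open>Writing the label term as a sum over all classes reduces the splitting to an
      identity for each j.\<close>
    have delta: "(c / \<tau>) *\<^sub>R n y = (\<Sum>j\<in>UNIV. ((if j = y then c else 0) / \<tau>) *\<^sub>R n j)" for c
    proof -
      have "((if j = y then c else 0) / \<tau>) *\<^sub>R n j = (if j = y then (c / \<tau>) *\<^sub>R n j else 0)" for j
        by simp
      then show ?thesis by simp
    qed
    let ?\<delta> = "\<lambda>c j. (if j = y then c else 0) / \<tau>"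
    have "(Q j *\<^sub>R (A j / \<tau>) *\<^sub>R n j - ?\<delta> (A y) j *\<^sub>R n j)
          - (P j *\<^sub>R (R j / \<tau>) *\<^sub>R n j - ?\<delta> (R y) j *\<^sub>R n j)
        = (1 / \<tau>) *\<^sub>R (((Q j - P j) * R j) *\<^sub>R n j + w j *\<^sub>R n j)" for j
    proof -
      have "Q j * (A j / \<tau>) - ?\<delta> (A y) j - (P j * (R j / \<tau>) - ?\<delta> (R y) j)
          = (1 / \<tau>) * ((Q j - P j) * R j + w j)"
        using \<open>\<tau> > 0\<close> by (cases "j = y") (simp_all add: w_def field_simps)
      then have "(Q j * (A j / \<tau>) - ?\<delta> (A y) j - (P j * (R j / \<tau>) - ?\<delta> (R y) j)) *\<^sub>R n j
          = ((1 / \<tau>) * ((Q j - P j) * R j + w j)) *\<^sub>R n j" by (rule arg_cong)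
      then show ?thesis
        by (simp only: scaleR_left_diff_distrib scaleR_left_distrib flip: scaleR_scaleR)
    qed
    then show ?thesis
      by (simp only: delta flip: sum_subtractf sum.distrib scaleR_sum_right)
  qed
  have "norm (\<Sum>j\<in>UNIV. ((Q j - P j) * R j) *\<^sub>R n j) \<le> (\<Sum>j\<in>UNIV. \<bar>(Q j - P j) * R j\<bar>)"
    by (intro norm_sum_scaleR_le n)
  also have "\<dots> \<le> (\<Sum>j\<in>UNIV. \<bar>P j - Q j\<bar>)"
    using R by (intro sum_mono) (auto simp: abs_mult abs_minus_commute intro!: mult_left_le)
  finally have 1: "norm (\<Sum>j\<in>UNIV. ((Q j - P j) * R j) *\<^sub>R n j) \<le> 2 * TV P Q"
    by (simp add: TV_def)
  have "norm (\<Sum>j\<in>UNIV. w j *\<^sub>R n j) \<le> (\<Sum>j\<in>UNIV. \<bar>w j\<bar>)"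
    by (intro norm_sum_scaleR_le n)
  also have "\<dots> = \<bar>w y\<bar> + (\<Sum>j\<in>UNIV - {y}. \<bar>w j\<bar>)"
    by (rule sum.remove) auto
  also have "\<dots> \<le> (1 - Q y) * a y + (\<Sum>j\<in>UNIV - {y}. Q j * a j)"
    using Q a by (intro add_mono sum_mono)
      (auto simp: w_def abs_mult abs_minus_commute intro!: mult_mono)
  finally have "norm (\<Sum>j\<in>UNIV. w j *\<^sub>R n j) \<le> (1 - Q y) * a y + (\<Sum>j\<in>UNIV - {y}. Q j * a j)" .
  with 1 have "norm ((\<Sum>j\<in>UNIV. ((Q j - P j) * R j) *\<^sub>R n j) + (\<Sum>j\<in>UNIV. w j *\<^sub>R n j))
      \<le> 2 * TV P Q + (\<Sum>j\<in>UNIV - {y}. Q j * a j) + (1 - Q y) * a y"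
    by (intro norm_triangle_le) linarith
  then show ?thesis
    unfolding g using \<open>\<tau> > 0\<close> by (simp add: divide_right_mono)
qed

section \<open>Score errors from the ratio error\<close>

text \<open>The gauge integral recovers the increment from the derivative B - A without continuity
  of A or B, and its integrability comes with it. Ordering the endpoints covers both s <= t and t <=
  s, as a swap only changes the sign of the increment.\<close>

lemma increment_diff_le_integral:
  fixes F G A B e :: "real \<Rightarrow> real"
  assumes F: "\<And>x. x \<ge> 0 \<Longrightarrow> (F has_real_derivative A x) (at x within {0..})"
    and G: "\<And>x. x \<ge> 0 \<Longrightarrow> (G has_real_derivative B x) (at x within {0..})"
    and st: "s \<ge> 0" "t \<ge> 0"
    and e: "e integrable_on {min s t..max s t}"
    and le: "\<And>x. x \<in> {min s t..max s t} \<Longrightarrow> \<bar>B x - A x\<bar> \<le> e x"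
  shows "\<bar>(G t - G s) - (F t - F s)\<bar> \<le> integral {min s t..max s t} e"
proof -
  let ?H = "\<lambda>x. G x - F x"
  have "((\<lambda>x. B x - A x) has_integral ?H (max s t) - ?H (min s t)) {min s t..max s t}"
  proof (rule fundamental_theorem_of_calculus)
    fix x
    assume x: "x \<in> {min s t..max s t}"
    have "(?H has_real_derivative B x - A x) (at x within {0..})"
      using x st by (intro derivative_intros F G) auto
    then show "(?H has_vector_derivative B x - A x) (at x within {min s t..max s t})"
      using st by (auto simp flip: has_real_derivative_iff_has_vector_derivative
          elim!: has_field_derivative_subset)
  qed simp
  note H = this
  have "norm (integral {min s t..max s t} (\<lambda>x. B x - A x)) \<le> integral {min s t..max s t} e"
    using le by (intro integral_norm_bound_integral has_integral_integrable[OF H] e) simp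
  then have "\<bar>?H (max s t) - ?H (min s t)\<bar> \<le> integral {min s t..max s t} e"
    by (simp only: integral_unique[OF H] real_norm_def)
  then show ?thesis by (cases "s \<le> t") (auto simp: min_def max_def)
qed

section \<open>Bounds for loss, probabilities and gradient\<close>

theorem proposition2:
  fixes \<nu> \<tau> d B\<^sub>L B\<^sub>P B\<^sub>g :: real
    and F A e :: "real \<Rightarrow> real"
    and \<mu> :: "'c::finite \<Rightarrow> real ^ 'p"
    and k c r q q' P \<pi> dd a Sp Sm l u :: "'c \<Rightarrow> real"
    and L L' :: "real ^ 'p \<Rightarrow> real"
    and f :: "real ^ 'p" and y :: 'c
  assumes dim: "CARD('p) \<ge> 5" and nu: "\<nu> = real CARD('p) / 2 - 1"
    and F_deriv: "\<And>x. x \<ge> 0 \<Longrightarrow> (F has_real_derivative A x) (at x within {0..})"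
    and A_0: "A 0 = 0"
    and classes: "CARD('c) \<ge> 2"
    and unit: "\<And>j. norm (\<mu> j) = 1"
    and k_nonneg: "\<And>j. k j \<ge> 0"
    and tau_pos: "\<tau> > 0"
    and r: "r = state_radius k \<mu> \<tau> f"
    and q: "q = score (bessel_Phi \<nu>) k \<mu> c \<tau> f"
    and q': "q' = score F k \<mu> c \<tau> f"
    and P: "P = softmax q" and pi: "\<pi> = softmax q'"
    and L: "L = (\<lambda>g. log_loss (score (bessel_Phi \<nu>) k \<mu> c \<tau> g) y)"
    and L': "L' = (\<lambda>g. log_loss (score F k \<mu> c \<tau> g) y)"
    and e_nonneg: "\<And>j x. x \<in> {min (k j) (r j)..max (k j) (r j)} \<Longrightarrow> 0 \<le> e x"
    and e_int: "\<And>j. e integrable_on {min (k j) (r j)..max (k j) (r j)}"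
    and e_bound: "\<And>j x. x \<in> {min (k j) (r j)..max (k j) (r j)} \<Longrightarrow>
                    \<bar>bessel_R \<nu> x - A x\<bar> \<le> e x"
    and dd: "\<And>j. dd j = integral {min (k j) (r j)..max (k j) (r j)} e"
    and d: "d = (MAX j. dd j)"
    and a: "\<And>j. \<bar>bessel_R \<nu> (r j) - A (r j)\<bar> \<le> a j"
    and Sp: "\<And>j. Sp j = (\<Sum>i\<in>UNIV - {j}. \<pi> i * (exp (dd i + dd j) - 1))"
    and Sm: "\<And>j. Sm j = (\<Sum>i\<in>UNIV - {j}. \<pi> i * (exp (- (dd i + dd j)) - 1))"
    and l: "\<And>j. l j = \<pi> j / (1 + Sp j)"
    and u: "\<And>j. u j = min 1 (\<pi> j / (1 + Sm j))"
    and B\<^sub>L: "B\<^sub>L = max (ln (1 + Sp y)) (- ln (1 + Sm y))"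
    and B\<^sub>P: "B\<^sub>P = min (tanh (d / 2)) ((1 / 2) * (\<Sum>j\<in>UNIV. max (\<pi> j - l j) (u j - \<pi> j)))"
    and B\<^sub>g: "B\<^sub>g = (2 * B\<^sub>P + (\<Sum>j\<in>UNIV - {y}. \<pi> j * a j) + (1 - \<pi> y) * a y) / \<tau>"
  shows "(\<forall>j. 1 + Sp j > 0 \<and> 1 + Sm j > 0)
    \<and> \<bar>L' f - L f\<bar> \<le> B\<^sub>L
    \<and> TV P \<pi> \<le> B\<^sub>P
    \<and> (\<exists>grad grad'. (GDERIV L f :> grad) \<and> (GDERIV L' f :> grad') \<and> norm (grad' - grad) \<le> B\<^sub>g)
    \<and> B\<^sub>L \<le> dd y + d
    \<and> B\<^sub>P \<le> tanh (d / 2)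
    \<and> B\<^sub>g \<le> (2 * tanh (d / 2) + (MAX j. a j) + a y) / \<tau>"
proof -
  have \<nu>: "\<nu> \<ge> 0" using dim by (simp add: nu)
  have r_nonneg: "r j \<ge> 0" for j by (simp add: r state_radius_def)
  define \<delta> where "\<delta> j = q j - q' j" for j
  have \<delta>: "\<bar>\<delta> j\<bar> \<le> dd j" for j
  proof -
    have "\<delta> j = (bessel_Phi \<nu> (r j) - bessel_Phi \<nu> (k j)) - (F (r j) - F (k j))"
      by (simp add: \<delta>_def q q' score_def r)
    also have "\<bar>\<dots>\<bar> \<le> integral {min (k j) (r j)..max (k j) (r j)} e"
      using increment_diff_le_integral[of F A "bessel_Phi \<nu>" "bessel_R \<nu>" "k j" "r j" e]
        F_deriv DERIV_bessel_Phi[OF _ \<nu>] k_nonneg r_nonneg e_int e_bound by blast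
    finally show ?thesis by (simp add: dd)
  qed
  have dd_nonneg: "dd j \<ge> 0" for j using \<delta>[of j] by linarith
  have dd_le: "dd j \<le> d" for j unfolding d by (intro Max_ge) auto
  have d_nonneg: "d \<ge> 0" using dd_nonneg[of y] dd_le[of y] by linarith
  have \<delta>_d: "\<bar>q j - q' j\<bar> \<le> d" for j
    using \<delta>[of j] dd_le[of j] by (simp add: \<delta>_def)
  have \<pi>_pos: "\<pi> j > 0" and P_pos: "P j > 0" for j by (simp_all add: pi P softmax_pos)
  have sum_rest: "sum \<pi> (UNIV - {j}) = 1 - \<pi> j" for j
    using sum_softmax[of q'] sum.remove[of UNIV j \<pi>] by (simp add: pi)
  have \<pi>_le: "\<pi> j \<le> 1" for j
    using sum_nonneg[of "UNIV - {j}" \<pi>] \<pi>_pos sum_rest[of j] by (force intro: less_imp_le)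
  have P_le: "P j \<le> 1" for j
    using member_le_sum[of j UNIV P] sum_softmax[of q] P_pos by (simp add: P less_imp_le)
  \<comment> \<open>The weights other than \<pi> j sum to 1 - \<pi> j, so the subtracted ones absorb
    the leading 1. The result has the shape of \<open>softmax_quotient\<close> and is visibly
    positive.\<close>
  have Sp': "1 + Sp j = \<pi> j + (\<Sum>i\<in>UNIV - {j}. \<pi> i * exp (dd i + dd j))" for j
    by (simp add: Sp right_diff_distrib sum_subtractf sum_rest)
  have Sm': "1 + Sm j = \<pi> j + (\<Sum>i\<in>UNIV - {j}. \<pi> i * exp (- (dd i + dd j)))" for j
    by (simp only: Sm right_diff_distrib sum_subtractf) (simp add: sum_rest)
  have Sp_pos: "1 + Sp j > 0" and Sm_pos: "1 + Sm j > 0" for j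
    unfolding Sp' Sm' by (auto intro!: add_pos_nonneg sum_nonneg mult_nonneg_nonneg \<pi>_pos less_imp_le[OF \<pi>_pos])
  have quot: "\<pi> j / P j = \<pi> j + (\<Sum>i\<in>UNIV - {j}. \<pi> i * exp (\<delta> i - \<delta> j))" for j
    unfolding pi P \<delta>_def by (rule softmax_quotient)
  \<comment> \<open>By these bounds, \<open>1 + Sm j\<close> and \<open>1 + Sp j\<close> enclose
    \<pi> j / P j term by term.\<close>
  have \<delta>_diff: "\<delta> i - \<delta> j \<le> dd i + dd j" "- (dd i + dd j) \<le> \<delta> i - \<delta> j" for i j
    using \<delta>[of i] \<delta>[of j] by linarith+
  have quot_le: "\<pi> j / P j \<le> 1 + Sp j" for j
    unfolding quot Sp'
    by (intro add_left_mono sum_mono mult_left_mono less_imp_le[OF \<pi>_pos])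
       (simp only: exp_le_cancel_iff \<delta>_diff)
  have quot_ge: "1 + Sm j \<le> \<pi> j / P j" for j
    unfolding quot Sm'
    by (intro add_left_mono sum_mono mult_left_mono less_imp_le[OF \<pi>_pos])
       (simp only: exp_le_cancel_iff \<delta>_diff)

  have loss: "\<bar>L' f - L f\<bar> \<le> B\<^sub>L"
  proof -
    have "L f - L' f = ln (\<pi> y) - ln (P y)"
      by (simp add: L L' log_loss_eq P pi q q')
    also have "\<dots> = ln (\<pi> y / P y)"
      using \<pi>_pos[of y] P_pos[of y] by (simp add: ln_div)
    finally have "L f - L' f = ln (\<pi> y / P y)" .
    moreover have "ln (1 + Sm y) \<le> ln (\<pi> y / P y)" "ln (\<pi> y / P y) \<le> ln (1 + Sp y)"
      using quot_le[of y] quot_ge[of y] Sm_pos[of y] by (simp_all add: ln_mono)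
    ultimately show ?thesis unfolding B\<^sub>L by linarith
  qed

  have TV: "TV P \<pi> \<le> B\<^sub>P"
  proof -
    \<comment> \<open>Inverting the enclosure of \<pi> j / P j gives both probability bounds; the
      cap 1 in \<open>u\<close> is the trivial bound on P j.\<close>
    have "l j \<le> P j" for j
      using quot_le[of j] Sp_pos[of j] P_pos[of j] by (simp add: l field_simps)
    moreover have "P j \<le> u j" for j
      using quot_ge[of j] Sm_pos[of j] P_pos[of j] P_le[of j] by (simp add: u field_simps)
    ultimately have "TV P \<pi> \<le> 1 / 2 * (\<Sum>j\<in>UNIV. max (\<pi> j - l j) (u j - \<pi> j))"
      by (rule TV_le_sum_max)
    moreover have "TV P \<pi> \<le> tanh (d / 2)"
      unfolding P pi using \<delta>_d by (rule TV_softmax_le_tanh)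
    ultimately show ?thesis by (simp add: B\<^sub>P)
  qed

  have grad: "\<exists>grad grad'. (GDERIV L f :> grad) \<and> (GDERIV L' f :> grad') \<and> norm (grad' - grad) \<le> B\<^sub>g"
  proof -
    \<comment> \<open>The unit direction of v_j, or 0 if v_j = 0; in either case its norm is at most
      1. Both gradients share these directions.\<close>
    define n where "n j = sgn (k j *\<^sub>R \<mu> j + f /\<^sub>R \<tau>)" for j
    have "GDERIV (\<lambda>g. score (bessel_Phi \<nu>) k \<mu> c \<tau> g j) f :> (bessel_R \<nu> (r j) / \<tau>) *\<^sub>R n j" for j
      unfolding n_def using r_nonneg[of j]
      by (intro GDERIV_score) (auto simp: r bessel_R_0[OF \<nu>] intro: DERIV_bessel_Phi[OF _ \<nu>])
    then have gL: "GDERIV L f :> (\<Sum>j\<in>UNIV. P j *\<^sub>R (bessel_R \<nu> (r j) / \<tau>) *\<^sub>R n j)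
        - (bessel_R \<nu> (r y) / \<tau>) *\<^sub>R n y"
      unfolding L P q by (rule GDERIV_log_loss)
    have "GDERIV (\<lambda>g. score F k \<mu> c \<tau> g j) f :> (A (r j) / \<tau>) *\<^sub>R n j" for j
      unfolding n_def using r_nonneg[of j]
      by (intro GDERIV_score) (auto simp: r A_0 intro: F_deriv)
    then have gL': "GDERIV L' f :> (\<Sum>j\<in>UNIV. \<pi> j *\<^sub>R (A (r j) / \<tau>) *\<^sub>R n j)
        - (A (r y) / \<tau>) *\<^sub>R n y"
      unfolding L' pi q' by (rule GDERIV_log_loss)
    have "norm (((\<Sum>j\<in>UNIV. \<pi> j *\<^sub>R (A (r j) / \<tau>) *\<^sub>R n j) - (A (r y) / \<tau>) *\<^sub>R n y)
        - ((\<Sum>j\<in>UNIV. P j *\<^sub>R (bessel_R \<nu> (r j) / \<tau>) *\<^sub>R n j) - (bessel_R \<nu> (r y) / \<tau>) *\<^sub>R n y))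
      \<le> (2 * TV P \<pi> + (\<Sum>j\<in>UNIV - {y}. \<pi> j * a j) + (1 - \<pi> y) * a y) / \<tau>"
      by (intro norm_gradient_diff_le a bessel_R_bounds r_nonneg \<nu> \<pi>_le tau_pos less_imp_le[OF \<pi>_pos])
         (simp add: n_def norm_sgn)
    also have "\<dots> \<le> B\<^sub>g"
      unfolding B\<^sub>g using TV tau_pos by (intro divide_right_mono) auto
    finally show ?thesis using gL gL' by blast
  qed

  have BL_le: "B\<^sub>L \<le> dd y + d"
  proof -
    let ?s = "dd y + d"
    \<comment> \<open>Here dd i <= d in every exponent, and the bare term \<pi> y is enlarged by a
      factor at least 1. All weights then carry the same factor and sum to one.\<close>
    have "1 + Sp y \<le> \<pi> y * exp ?s + (\<Sum>i\<in>UNIV - {y}. \<pi> i * exp ?s)"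
      unfolding Sp' using \<pi>_pos[of y] dd_nonneg[of y] dd_le d_nonneg
      by (intro add_mono sum_mono mult_left_mono less_imp_le[OF \<pi>_pos])
         (auto simp: add.commute)
    also have "\<dots> = exp ?s"
      by (simp add: sum_rest algebra_simps flip: sum_distrib_right)
    finally have up: "1 + Sp y \<le> exp ?s" .
    have "exp (- ?s) = \<pi> y * exp (- ?s) + (\<Sum>i\<in>UNIV - {y}. \<pi> i * exp (- ?s))"
      by (simp only: sum_rest flip: sum_distrib_right) (simp add: algebra_simps)
    also have "\<dots> \<le> 1 + Sm y"
      unfolding Sm' using \<pi>_pos[of y] dd_nonneg[of y] dd_le d_nonneg
      by (intro add_mono sum_mono mult_left_mono less_imp_le[OF \<pi>_pos])
         (auto simp: add.commute)
    finally have low: "exp (- ?s) \<le> 1 + Sm y" .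
    have "ln (1 + Sp y) \<le> ?s" using ln_mono[OF up Sp_pos] by simp
    moreover have "- ?s \<le> ln (1 + Sm y)" using low Sm_pos[of y] by (simp add: ln_ge_iff)
    ultimately show ?thesis unfolding B\<^sub>L by linarith
  qed

  have BP_le: "B\<^sub>P \<le> tanh (d / 2)" by (simp add: B\<^sub>P)

  have Bg_le: "B\<^sub>g \<le> (2 * tanh (d / 2) + (MAX j. a j) + a y) / \<tau>"
  proof -
    let ?M = "MAX j. a j"
    have a_nonneg: "a j \<ge> 0" for j using a[of j] by linarith
    have a_le: "a j \<le> ?M" for j by (intro Max_ge) auto
    have M: "?M \<ge> 0" using a_nonneg[of y] a_le[of y] by linarith
    \<comment> \<open>The weights away from y have mass 1 - \<pi> y <= 1, so their average error is
      at most the maximum.\<close>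
    have "(\<Sum>j\<in>UNIV - {y}. \<pi> j * a j) \<le> (\<Sum>j\<in>UNIV - {y}. \<pi> j * ?M)"
      by (intro sum_mono mult_left_mono a_le less_imp_le[OF \<pi>_pos])
    also have "\<dots> = (1 - \<pi> y) * ?M" by (simp only: sum_rest flip: sum_distrib_right)
    also have "\<dots> \<le> ?M" using \<pi>_pos[of y] M by (simp add: mult_left_le_one_le \<pi>_le)
    finally have "(\<Sum>j\<in>UNIV - {y}. \<pi> j * a j) \<le> ?M" .
    moreover have "(1 - \<pi> y) * a y \<le> a y"
      using \<pi>_pos[of y] a_nonneg[of y] by (simp add: mult_left_le_one_le \<pi>_le)
    ultimately show ?thesis
      unfolding B\<^sub>g using BP_le tau_pos by (intro divide_right_mono) auto
  qed

  show ?thesis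
    using Sp_pos Sm_pos loss TV grad BL_le BP_le Bg_le by blast
qed

end
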